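(* Let $\boldsymbol\phi(n,m,\alpha,\beta,l)\in\mathbb C^N$ satisfy the condition equation set (for all arguments, only the indicated variable shifted) $\sigma_1\boldsymbol\phi(n-1,\cdot,l)=\boldsymbol\phi(n,\cdot,l)-\boldsymbol\phi(n-1,\cdot,l+1)$, $\sigma_2\boldsymbol\phi(m-1,\cdot,l)=\boldsymbol\phi(m,\cdot,l)-\boldsymbol\phi(m-1,\cdot,l+1)$, $\sigma_3\boldsymbol\phi(\alpha-1,\cdot,l)=\boldsymbol\phi(\alpha,\cdot,l)-\boldsymbol\phi(\alpha-1,\cdot,l+1)$, $\sigma_4\boldsymbol\phi(\beta-1,\cdot,l)=\boldsymbol\phi(\beta,\cdot,l)-\boldsymbol\phi(\beta-1,\cdot,l+1)$, and $\boldsymbol K\boldsymbol\phi(l)=\boldsymbol\phi(l+4)-\epsilon_1\boldsymbol\phi(l+3)+\epsilon_2\boldsymbol\phi(l+2)-\epsilon_3\boldsymbol\phi(l+1)$ for a constant $N\times N$ matrix $\boldsymbol K$. Let $f'=|0,\dots,N-1|$, $g'=|0,\dots,N-2,N|$, $h'=|0,\dots,N-2,N+1|$, $s'=|0,\dots,N-3,N-1,N|$ (Casoratians of $\boldsymbol\phi$). Then $$f'(\sigma_3\widetilde{\check f}'+\widetilde{\check g}')+(\sigma_1-\sigma_3)\widetilde f'\check f'-(\sigma_1f'+g')\widetilde{\check f}'=0,\quad f'(\sigma_3\widehat{\check f}'+\widehat{\check g}')+(\sigma_2-\sigma_3)\widehat f'\check f'-(\sigma_2f'+g')\widehat{\check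 f}'=0,$$ $$f'(\sigma_3^2\widetilde{\check f}'+\sigma_3\widetilde{\check g}'+\widetilde{\check s}')-\sigma_1f'(\sigma_3\widetilde{\check f}'+\widetilde{\check g}')+(\sigma_1-\sigma_3)\widetilde f'(\sigma_3\check f'+\check g')-\widetilde{\check f}'s'=0,$$ $$f'(\sigma_3^2\widehat{\check f}'+\sigma_3\widehat{\check g}'+\widehat{\check s}')-\sigma_2f'(\sigma_3\widehat{\check f}'+\widehat{\check g}')+(\sigma_2-\sigma_3)\widehat f'(\sigma_3\check f'+\check g')-\widehat{\check f}'s'=0,$$ $$\widetilde f'(\sigma_1g'+h')-\widetilde g'(\sigma_1f'+g')+f'\widetilde s'=0,\qquad \widehat f'(\sigma_2g'+h')-\widehat g'(\sigma_2f'+g')+f'\widehat s'=0,$$ $$(\sigma_1-\sigma_2)(\widetilde f'\widehat f'-f'\widehat{\widetilde f}')+\widetilde f'\widehat g'-\widehat f'\widetilde g'=0,$$ $$\big[Q(\sigma_1,\sigma_2)\check f'\widehat{\widetilde f}'+\check f'\widehat{\widetilde h}'-(\sigma_1+\sigma_2+\epsilon_1)\check f'\widehat{\widetilde g}'+((\sigma_1+\sigma_2+\epsilon_1)\widehat{\widetilde f}'-\widehat{\widetilde g}')(\sigma_3\check f'+\check g')+\widehat{\widetilde f}'(\sigma_3^2\check f'+\sigma_3\check g'+\check s')\big](\sigma_1-\sigma_2)-R(\sigma_1,\sigma_3)\widehat f'\widetilde{\check f}'+R(\sigma_2,\sigma_3)\widetilde f'\widehat{\check f}'=0.$$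
   Context: Fix $\alpha_1,\alpha_2,\alpha_3,\delta\in\mathbb C$ and pairwise distinct $p,q,a,b\in\mathbb C$. Put $\sigma_1=p-\delta$, $\sigma_2=q-\delta$, $\sigma_3=a-\delta$, $\sigma_4=b-\delta$; $\epsilon_1=4\delta-\alpha_3$, $\epsilon_2=6\delta^2-3\delta\alpha_3+\alpha_2$, $\epsilon_3=4\delta^3-3\delta^2\alpha_3+2\delta\alpha_2-\alpha_1$; $Q(x,y)=(x+y)^2-xy+\epsilon_1(x+y)+\epsilon_2$; $R(x,y)=(x+y)(x^2+y^2)+\epsilon_1((x+y)^2-xy)+\epsilon_2(x+y)+\epsilon_3$. Casoratian notation: $|l_1,\dots,l_N|=\det(\boldsymbol\phi(l_1),\dots,\boldsymbol\phi(l_N))$ with $\boldsymbol\phi(l)=\boldsymbol\phi(n,m,\alpha,\beta,l)$; a run "$0,\dots,j$" with $j<0$ is empty, and if the listed indices number more than $N$ the symbol is $0$. Shifts: $\widetilde F=F(n+1,m,\alpha)$, $\widehat F=F(n,m+1,\alpha)$, $\check F=F(n,m,\alpha-1)$, composed as needed. *)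

theory Defs
  imports "Jordan_Normal_Form.Determinant"
begin

definition cas :: "nat \<Rightarrow> (nat \<Rightarrow> complex vec) \<Rightarrow> nat list \<Rightarrow> complex" where
  "cas N v ls = (if N < length ls then 0 else det (mat N N (\<lambda>(i,j). v (ls ! j) $ i)))"

text \<open>Index lists: f' = |0..N-1|, g' = |0..N-2,N|, h' = |0..N-2,N+1|, s' = |0..N-3,N-1,N|
 (a run 0..j with j<0 is empty).\<close>
definition f_idx :: "nat \<Rightarrow> nat list" where "f_idx N = [0..<N]"
definition g_idx :: "nat \<Rightarrow> nat list" where "g_idx N = [0..<N-1] @ [N]"
definition h_idx :: "nat \<Rightarrow> nat list" where "h_idx N = [0..<N-1] @ [N+1]"
definition s_idx :: "nat \<Rightarrow> nat list" where "s_idx N = [0..<N-2] @ [N-1, N]"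

definition Qpol :: "complex \<Rightarrow> complex \<Rightarrow> complex \<Rightarrow> complex \<Rightarrow> complex" where
  "Qpol e1 e2 x y = (x+y)^2 - x*y + e1*(x+y) + e2"

definition Rpol :: "complex \<Rightarrow> complex \<Rightarrow> complex \<Rightarrow> complex \<Rightarrow> complex \<Rightarrow> complex" where
  "Rpol e1 e2 e3 x y = (x+y)*(x^2+y^2) + e1*((x+y)^2 - x*y) + e2*(x+y) + e3"

end

theory Submission
  imports Defs
begin

text \<open>
  Extend \<open>l \<mapsto> \<phi>(l)\<close> to the linear map \<open>x^l \<mapsto> \<phi>(l)\<close> on polynomials, so that raising a lattice
  variable becomes multiplication by \<open>x + \<sigma>\<close>. The kernel polynomial \<open>T\<close>, the bordered determinant
  with last row \<open>1, x, \<dots>, x^N\<close>, is annihilated by this map; its leading coefficients are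
  \<open>f, -g, s\<close>, and \<open>T(-\<sigma>)\<close> is up to sign the \<open>f\<close> shifted in the direction of \<open>\<sigma>\<close>.

  Let \<open>\<omega>(P) = |\<psi>(0), \<dots>, \<psi>(N-2), P|\<close> with \<open>\<psi>\<close> obtained from \<open>\<phi>\<close> by shifts in three directions.
  Lagrange interpolation of \<open>T\<close> at \<open>-\<sigma>\<^sub>1, -\<sigma>\<^sub>2, -\<sigma>\<^sub>3\<close> turns \<open>\<omega>(T) = 0\<close> into the Hirota--Miwa
  equation. Reading one direction as the polynomial variable and comparing the two leading
  coefficients gives the identities without \<open>h\<close>. The ones with \<open>h\<close> and a single shift are
  \<open>\<omega>((x + \<sigma>) T) = 0\<close> with \<open>T\<close> shifted in the direction of \<open>\<sigma>\<close> and \<open>\<psi> = \<phi>\<close>.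

  With \<open>G(x) = x^4 + \<epsilon>\<^sub>1 x^3 + \<epsilon>\<^sub>2 x^2 + \<epsilon>\<^sub>3 x\<close> the condition on \<open>K\<close> also gives
  \<open>\<omega>(G(-x) T) = 0\<close>, and since \<open>G(x) - G(y) = (x - y) R(x, y)\<close> the same interpolation yields the
  last identity.
\<close>

section \<open>Shift operators and polynomials acting on sequences\<close>

definition shift :: "complex \<Rightarrow> (nat \<Rightarrow> complex) \<Rightarrow> nat \<Rightarrow> complex" where
  "shift y u = (\<lambda>l. y * u l + u (Suc l))"

definition apply_poly :: "(nat \<Rightarrow> complex) \<Rightarrow> complex poly \<Rightarrow> complex" where
  "apply_poly u P = (\<Sum>i\<le>degree P. coeff P i * u i)"

lemma shift_commute: "shift a (shift b u) = shift b (shift a u)"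
  by (auto simp: shift_def algebra_simps)

lemma shift_lincomb:
  "shift y (\<lambda>l. \<Sum>i\<in>I. w i * X i l) = (\<lambda>l. \<Sum>i\<in>I. w i * shift y (X i) l)"
  by (auto simp: shift_def sum_distrib_left sum.distrib algebra_simps)

lemma apply_poly_eq_sum:
  assumes "degree P \<le> n"
  shows "apply_poly u P = (\<Sum>i\<le>n. coeff P i * u i)"
  unfolding apply_poly_def
  by (rule sum.mono_neutral_left) (use assms in \<open>auto simp: coeff_eq_0\<close>)

lemma apply_poly_add: "apply_poly u (P + Q) = apply_poly u P + apply_poly u Q"
proof -
  let ?n = "max (degree P) (degree Q)"
  have "degree (P + Q) \<le> ?n" by (rule degree_add_le_max)
  then show ?thesis
    by (simp add: apply_poly_eq_sum[of _ ?n] sum.distrib algebra_simps)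
qed

lemma apply_poly_smult: "apply_poly u (smult a P) = a * apply_poly u P"
  by (subst apply_poly_eq_sum[of _ "degree P"])
    (auto simp: apply_poly_def sum_distrib_left algebra_simps degree_smult_le)

lemma apply_poly_diff: "apply_poly u (P - Q) = apply_poly u P - apply_poly u Q"
  using apply_poly_add[of u "P - Q" Q] by simp

lemma apply_poly_pCons: "apply_poly u (pCons a P) = a * u 0 + apply_poly (\<lambda>l. u (Suc l)) P"
  by (subst apply_poly_eq_sum[of _ "Suc (degree P)"])
    (auto simp: apply_poly_def sum.atMost_Suc_shift degree_pCons_le simp del: sum.atMost_Suc)

lemma apply_poly_0: "apply_poly u 0 = 0"
  by (simp add: apply_poly_def)

lemma apply_poly_lincomb: "apply_poly (\<lambda>l. \<Sum>i\<in>I. w i * X i l) P = (\<Sum>i\<in>I. w i * apply_poly (X i) P)"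
  unfolding apply_poly_def sum_distrib_left
  by (subst sum.swap) (simp add: algebra_simps)

text \<open>Multiplication by x raises every index by one, so multiplication by x + y on polynomials
  is dual to \<open>shift y\<close> on sequences.\<close>

lemma apply_poly_linear_factor: "apply_poly u ([:y, 1:] * P) = apply_poly (shift y u) P"
proof -
  have "apply_poly u ([:y, 1:] * P) = y * apply_poly u P + apply_poly (\<lambda>l. u (Suc l)) P"
    by (simp add: apply_poly_add apply_poly_smult apply_poly_pCons)
  also have "\<dots> = apply_poly (shift y u) P"
    by (simp add: apply_poly_def shift_def sum_distrib_left sum.distrib algebra_simps)
  finally show ?thesis .
qed

lemma apply_poly_powers: "apply_poly (\<lambda>l. x ^ l) P = poly P x"
  by (simp add: apply_poly_def poly_altdef)

text \<open>Meant for sequences of determinants that vanish below \<open>M\<close> because of a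
  repeated column; the three surviving values are then f, g and h.\<close>

lemma apply_poly_top_three:
  assumes "degree P \<le> M + 2" and "\<And>l. l < M \<Longrightarrow> u l = 0"
  shows "apply_poly u P = coeff P M * u M + coeff P (M + 1) * u (M + 1) + coeff P (M + 2) * u (M
      + 2)"
proof -
  have *: "u i = 0" if "i \<in> {..M + 2} - {M, M + 1, M + 2}" for i
    using that by (intro assms(2)) auto
  have "apply_poly u P = (\<Sum>i\<le>M + 2. coeff P i * u i)" by (rule apply_poly_eq_sum[OF assms(1)])
  also have "\<dots> = (\<Sum>i\<in>{M, M + 1, M + 2}. coeff P i * u i)"
    by (rule sum.mono_neutral_right) (use * in auto)
  finally show ?thesis by simp
qed

text \<open>\<open>P\<close> and \<open>r\<close> agree at -s1, -s2, -s3, so \<open>r\<close> is the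
  Lagrange interpolant there. Its basis polynomial at -s1 is a multiple of (x + s2)(x + s3), on
  which the functional takes the value \<open>shift s2 (shift s3 u) 0\<close>. The Vandermonde
  product clears the denominators.\<close>

lemma apply_poly_interpolation:
  fixes s1 s2 s3 :: complex
  assumes P: "P = [:s1, 1:] * ([:s2, 1:] * ([:s3, 1:] * q)) + r" and r: "degree r \<le> 2"
  shows "(s1 - s2) * (s1 - s3) * (s2 - s3) * (apply_poly u P
      - apply_poly (shift s3 (shift s2 (shift s1 u))) q) =
    (s2 - s3) * poly P (- s1) * shift s2 (shift s3 u) 0
    - (s1 - s3) * poly P (- s2) * shift s1 (shift s3 u) 0
    + (s1 - s2) * poly P (- s3) * shift s1 (shift s2 u) 0"
proof -
  obtain a b c where r': "r = [:a, b, c:]"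
  proof -
    have "r = [:coeff r 0, coeff r 1, coeff r 2:]"
      using r by (intro poly_eqI)
        (auto simp: coeff_pCons coeff_eq_0 numeral_2_eq_2 split: nat.split)
    then show ?thesis by (rule that)
  qed
  have "apply_poly u P = apply_poly (shift s3 (shift s2 (shift s1 u))) q + apply_poly u r"
    unfolding P apply_poly_add apply_poly_linear_factor ..
  then have 1: "apply_poly u P - apply_poly (shift s3 (shift s2 (shift s1 u))) q =
      a * u 0 + b * u 1 + c * u 2"
    by (simp add: r' apply_poly_pCons apply_poly_0 numeral_2_eq_2)
  have 2: "poly P (- s1) = a - b * s1 + c * s1^2" "poly P (- s2) = a - b * s2 + c * s2^2"
    "poly P (- s3) = a - b * s3 + c * s3^2"
    by (simp_all add: P r' algebra_simps power2_eq_square)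
  show ?thesis
    unfolding 1 2 by (simp add: shift_def numeral_2_eq_2 algebra_simps)
qed

section \<open>The kernel polynomial\<close>

definition bordered :: "nat \<Rightarrow> (nat \<Rightarrow> nat \<Rightarrow> complex) \<Rightarrow> (nat \<Rightarrow> complex) \<Rightarrow> complex mat" where
  "bordered N X r = mat (Suc N) (Suc N) (\<lambda>(i, j). if i < N then X i j else r j)"

text \<open>Cofactors along the last row do not see that row, so the zero border is only a
  placeholder.\<close>

definition kernel_poly :: "nat \<Rightarrow> (nat \<Rightarrow> nat \<Rightarrow> complex) \<Rightarrow> complex poly" where
  "kernel_poly N X = (\<Sum>k\<le>N. monom (cofactor (bordered N X (\<lambda>_. 0)) N k) k)"

text \<open>The Casoratian on 0..N with index k left out; k = N, N-1, N-2 give f, g, s.\<close>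

definition minor :: "nat \<Rightarrow> (nat \<Rightarrow> nat \<Rightarrow> complex) \<Rightarrow> nat \<Rightarrow> complex" where
  "minor N X k = det (mat N N (\<lambda>(i, j). X i (if j < k then j else Suc j)))"

lemma cofactor_bordered:
  assumes "k \<le> N"
  shows "cofactor (bordered N X r) N k = (- 1) ^ (N + k) * minor N X k"
proof -
  have "mat_delete (bordered N X r) N k = mat N N (\<lambda>(i, j). X i (if j < k then j else Suc j))"
    using assms by (intro eq_matI) (auto simp: mat_delete_def bordered_def)
  then show ?thesis by (simp add: cofactor_def minor_def)
qed

lemma coeff_kernel_poly: "coeff (kernel_poly N X) k =
    (if k \<le> N then (- 1) ^ (N + k) * minor N X k else 0)"
  by (auto simp: kernel_poly_def coeff_sum cofactor_bordered)

lemma degree_kernel_poly: "degree (kernel_poly N X) \<le> N"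
  by (rule degree_le) (simp add: coeff_kernel_poly)

lemma det_bordered: "det (bordered N X r) = apply_poly r (kernel_poly N X)"
proof -
  have "det (bordered N X r) = (\<Sum>j<Suc N. bordered N X r $$ (N, j) * cofactor (bordered N X r) N j)"
    by (rule laplace_expansion_row) (auto simp: bordered_def)
  also have "\<dots> = (\<Sum>j\<le>N. coeff (kernel_poly N X) j * r j)"
    by (intro sum.cong) (auto simp: bordered_def[of N X r]
        coeff_kernel_poly cofactor_bordered[unfolded bordered_def])
  also have "\<dots> = apply_poly r (kernel_poly N X)"
    by (rule apply_poly_eq_sum[OF degree_kernel_poly, symmetric])
  finally show ?thesis .
qed

text \<open>With a second copy of row \<open>i\<close> as border the determinant has two equal
  rows.\<close>

lemma apply_poly_row_kernel_poly:
  assumes "i < N"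
  shows "apply_poly (X i) (kernel_poly N X) = 0"
  unfolding det_bordered[symmetric]
proof (rule det_identical_rows[of _ "Suc N" i N])
  show "row (bordered N X (X i)) i = row (bordered N X (X i)) N"
    using assms by (intro eq_vecI) (auto simp: bordered_def)
qed (use assms in \<open>auto simp: bordered_def\<close>)

text \<open>The column operations taking \<open>c(0), \<dots>, c(M)\<close> to the \<open>M\<close> shifted columns
  \<open>y c(0) + c(1), \<dots>, y c(M-1) + c(M)\<close> followed by \<open>c(0)\<close>.\<close>

definition shift_mat :: "nat \<Rightarrow> complex \<Rightarrow> complex mat" where
  "shift_mat M y = mat (Suc M) (Suc M) (\<lambda>(i, j). if j < M
     then (if i = j then y else if i = Suc j then 1 else 0) else (if i = 0 then 1 else 0))"

lemma det_shift_mat: "det (shift_mat M y) = (- 1) ^ M"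
proof -
  let ?B = "shift_mat M y"
  have "det ?B = (\<Sum>i<Suc M. ?B $$ (i, M) * cofactor ?B i M)"
    by (rule laplace_expansion_column) (auto simp: shift_mat_def)
  also have "\<dots> = (\<Sum>i<Suc M. if i = 0 then cofactor ?B 0 M else 0)"
    by (intro sum.cong) (auto simp: shift_mat_def)
  also have "\<dots> = (- 1) ^ M * det (mat_delete ?B 0 M)"
    by (simp add: cofactor_def)
  \<comment> \<open>Without row 0 and the last column the entries 1 form the diagonal and the
    entries \<open>y\<close> lie just above it.\<close>
  also have "det (mat_delete ?B 0 M) = prod_list (diag_mat (mat_delete ?B 0 M))"
    by (rule det_upper_triangular[of _ M])
      (auto simp: mat_delete_def shift_mat_def)
  also have "diag_mat (mat_delete ?B 0 M) = map (\<lambda>_. 1) [0..<M]"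
    by (auto simp: diag_mat_def mat_delete_def shift_mat_def)
  finally show ?thesis by (simp add: map_replicate_const)
qed

lemma mult_shift_mat:
  "mat (Suc M) (Suc M) (\<lambda>(i, j). X i j) * shift_mat M y =
    mat (Suc M) (Suc M) (\<lambda>(i, j). if j < M then shift y (X i) j else X i 0)"
proof (intro eq_matI)
  fix i j
  assume "i < dim_row (mat (Suc M) (Suc M) (\<lambda>(i, j). if j < M then shift y (X i) j else X i 0))"
    and "j < dim_col (mat (Suc M) (Suc M) (\<lambda>(i, j). if j < M then shift y (X i) j else X i 0))"
  then have ij: "i < Suc M" "j < Suc M" by auto
  have "(mat (Suc M) (Suc M) (\<lambda>(i, j). X i j) * shift_mat M y) $$ (i, j) =
     (\<Sum>k<Suc M. X i k * shift_mat M y $$ (k, j))"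
    using ij by (simp add: scalar_prod_def atLeast0LessThan shift_mat_def del: sum.lessThan_Suc)
  also have "\<dots> = (\<Sum>k<Suc M. (if k = j then (if j < M then y * X i j else 0) else 0)
      + (if k = Suc j then (if j < M then X i (Suc j) else 0) else 0)
      + (if k = 0 then (if j < M then 0 else X i 0) else 0))"
    using ij by (intro sum.cong) (auto simp: shift_mat_def)
  also have "\<dots> = (if j < M then shift y (X i) j else X i 0)"
    using ij by (simp add: sum.distrib shift_def del: sum.lessThan_Suc)
  finally show "(mat (Suc M) (Suc M) (\<lambda>(i, j). X i j) * shift_mat M y) $$ (i, j) =
      mat (Suc M) (Suc M) (\<lambda>(i, j). if j < M then shift y (X i) j else X i 0) $$ (i, j)"
    using ij by simp
qed (auto simp: shift_mat_def)

lemma det_shifted_columns: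
  "det (mat (Suc M) (Suc M) (\<lambda>(i, j). if j < M then shift y (X i) j else X i 0)) =
    (- 1) ^ M * det (mat (Suc M) (Suc M) (\<lambda>(i, j). X i j))"
  unfolding mult_shift_mat[symmetric]
  by (subst det_mult[of _ "Suc M"]) (auto simp: det_shift_mat, auto simp: shift_mat_def)

section \<open>Determinants as linear functionals of the last column\<close>

definition det_lastcol :: "nat \<Rightarrow> (nat \<Rightarrow> nat \<Rightarrow> complex) \<Rightarrow> (nat \<Rightarrow> complex) \<Rightarrow> complex" where
  "det_lastcol M Y v = det (mat (Suc M) (Suc M) (\<lambda>(i, j). if j < M then Y i j else v i))"

definition det_f :: "nat \<Rightarrow> (nat \<Rightarrow> nat \<Rightarrow> complex) \<Rightarrow> complex" where
  "det_f N X = det (mat N N (\<lambda>(i, j). X i j))"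

text \<open>By the condition equations, raising a lattice variable by one acts on the array of
  entries in this way.\<close>

definition shift_rows :: "complex \<Rightarrow> (nat \<Rightarrow> nat \<Rightarrow> complex) \<Rightarrow> nat \<Rightarrow> nat \<Rightarrow> complex" where
  "shift_rows y X = (\<lambda>i. shift y (X i))"

lemma shift_rows_commute: "shift_rows a (shift_rows b X) = shift_rows b (shift_rows a X)"
  by (simp add: shift_rows_def shift_commute[of a b])

text \<open>Identifies the values at index 0 produced by interpolation as f at a lattice
  point.\<close>

lemma det_lastcol_shift_rows: "det_lastcol M (shift_rows y X) (\<lambda>i. X i 0) = (- 1) ^ M
    * det_f (Suc M) X"
  unfolding det_lastcol_def det_f_def shift_rows_def by (rule det_shifted_columns)

lemma minor_last: "minor N X N = det_f N X"
  unfolding minor_def det_f_def by (rule arg_cong[where f = det]) (auto intro!: eq_matI)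

text \<open>The border row of powers of -y is geometric, so the column operations with parameter
  \<open>y\<close> annihilate it except for the entry 1 in the last column. What remains is f of the
  shifted rows; the sign is the determinant of the column operations.\<close>

lemma poly_kernel_poly: "poly (kernel_poly N X) (- y) = (- 1) ^ N * det_f N (shift_rows y X)"
proof -
  define Z where "Z = (\<lambda>i j. if i < N then X i j else (- y) ^ j)"
  define Y where "Y = (\<lambda>i j. if j < N then shift y (X i) j else X i 0)"
  have "poly (kernel_poly N X) (- y) = det (mat (Suc N) (Suc N) (\<lambda>(i, j). Z i j))"
    unfolding apply_poly_powers[symmetric] det_bordered[symmetric] bordered_def Z_def ..
  moreover have "mat (Suc N) (Suc N) (\<lambda>(i, j). if j < N then shift y (Z i) j else Z i 0) =
      bordered N Y (\<lambda>j. if j < N then 0 else 1)"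
    by (intro eq_matI) (auto simp: bordered_def Y_def Z_def shift_def)
  moreover have "det (bordered N Y (\<lambda>j. if j < N then 0 else 1)) = coeff (kernel_poly N Y) N"
    unfolding det_bordered
    by (subst apply_poly_eq_sum[OF degree_kernel_poly]) (simp add: sum.remove[of _ N])
  moreover have "det_f N Y = det_f N (shift_rows y X)"
    unfolding det_f_def shift_rows_def Y_def by (rule arg_cong[where f = det])
        (auto intro!: eq_matI)
  ultimately have "(- 1) ^ N * poly (kernel_poly N X) (- y) = det_f N (shift_rows y X)"
    using det_shifted_columns[of N y Z] by (simp add: coeff_kernel_poly minor_last)
  then have "(- 1) ^ N * ((- 1) ^ N * poly (kernel_poly N X) (- y)) = (- 1) ^ N
      * det_f N (shift_rows y X)"
    by simp
  then show ?thesis by (simp flip: mult.assoc power_mult_distrib)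
qed

lemma det_lastcol_linear: "\<exists>w. \<forall>v. det_lastcol M Y v = (\<Sum>i<Suc M. w i * v i)"
proof -
  let ?A = "\<lambda>v. mat (Suc M) (Suc M) (\<lambda>(i, j). if j < M then Y i j else v i)"
  have "det_lastcol M Y v = (\<Sum>i<Suc M. cofactor (?A (\<lambda>_. 0)) i M * v i)" for v
  proof -
    have "mat_delete (?A v) i M = mat_delete (?A (\<lambda>_. 0)) i M" for i
      by (intro eq_matI) (auto simp: mat_delete_def)
    then have "cofactor (?A v) i M = cofactor (?A (\<lambda>_. 0)) i M" for i
      by (simp add: cofactor_def)
    moreover have "det (?A v) = (\<Sum>i<Suc M. ?A v $$ (i, M) * cofactor (?A v) i M)"
      by (rule laplace_expansion_column) auto
    ultimately show ?thesis
      unfolding det_lastcol_def by (simp add: mult.commute)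
  qed
  then show ?thesis by (intro exI[of _ "\<lambda>i. cofactor (?A (\<lambda>_. 0)) i M"]) blast
qed

lemma det_lastcol_repeat:
  assumes "l < M"
  shows "det_lastcol M Y (\<lambda>i. Y i l) = 0"
  unfolding det_lastcol_def
  by (rule det_identical_columns[of _ "Suc M" l M]) (use assms in \<open>auto intro!: eq_vecI\<close>)

text \<open>The weights depend on \<open>Y\<close> alone, so one choice serves both an array and its
  shift.\<close>

lemma det_lastcol_lincomb:
  obtains w where "\<And>X :: nat \<Rightarrow> nat \<Rightarrow> complex. (\<lambda>l. det_lastcol M Y (\<lambda>i. X i l))
      = (\<lambda>l. \<Sum>i<Suc M. w i * X i l)"
  using det_lastcol_linear[of M Y] by blast

text \<open>The functional combines rows while the shift acts on the column index, so the two
  commute.\<close>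

lemma shift_det_lastcol:
  "shift y (\<lambda>l. det_lastcol M Y (\<lambda>i. X i l)) = (\<lambda>l. det_lastcol M Y (\<lambda>i. shift_rows y X i l))"
proof -
  obtain w where w: "\<And>X :: nat \<Rightarrow> nat \<Rightarrow> complex. (\<lambda>l. det_lastcol M Y (\<lambda>i. X i l))
      = (\<lambda>l. \<Sum>i<Suc M. w i * X i l)"
    using det_lastcol_lincomb by blast
  show ?thesis
    using w[of "shift_rows y X"] unfolding w[of X] shift_lincomb shift_rows_def by simp
qed

lemma apply_poly_det_lastcol_eq_0:
  assumes "\<And>i. i < Suc M \<Longrightarrow> apply_poly (X i) P = 0"
  shows "apply_poly (\<lambda>l. det_lastcol M Y (\<lambda>i. X i l)) P = 0"
proof -
  obtain w where w: "\<And>X :: nat \<Rightarrow> nat \<Rightarrow> complex. (\<lambda>l. det_lastcol M Y (\<lambda>i. X i l))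
      = (\<lambda>l. \<Sum>i<Suc M. w i * X i l)"
    using det_lastcol_lincomb by blast
  show ?thesis unfolding w[of X] apply_poly_lincomb by (rule sum.neutral) (use assms in auto)
qed

text \<open>In \<open>det_g\<close>, \<open>det_h\<close>, \<open>det_s\<close> the size is \<open>N = M + 1\<close>; \<open>s\<close> lists two indices
  when \<open>N = 1\<close>, whence the value \<open>0\<close> for \<open>M = 0\<close>.\<close>

definition det_g :: "nat \<Rightarrow> (nat \<Rightarrow> nat \<Rightarrow> complex) \<Rightarrow> complex" where
  "det_g M X = det_lastcol M X (\<lambda>i. X i (M + 1))"

definition det_h :: "nat \<Rightarrow> (nat \<Rightarrow> nat \<Rightarrow> complex) \<Rightarrow> complex" where
  "det_h M X = det_lastcol M X (\<lambda>i. X i (M + 2))"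

definition det_s :: "nat \<Rightarrow> (nat \<Rightarrow> nat \<Rightarrow> complex) \<Rightarrow> complex" where
  "det_s M X = (if M = 0 then 0 else minor (Suc M) X (M - 1))"

section \<open>Casoratians as leading coefficients of the kernel polynomial\<close>

lemma det_lastcol_self: "det_lastcol M X (\<lambda>i. X i M) = det_f (Suc M) X"
  unfolding det_lastcol_def det_f_def
  by (rule arg_cong[where f = det]) (auto intro!: eq_matI simp: less_Suc_eq)

lemma minor_det_g: "minor (Suc M) X M = det_g M X"
  unfolding minor_def det_g_def det_lastcol_def
  by (rule arg_cong[where f = det]) (auto intro!: eq_matI simp: less_Suc_eq)

text \<open>The guard is essential: for M = 0 truncated subtraction would turn M - 1 into 0 and
  return -g in place of s = 0.\<close>

lemma coeff_kernel_poly_top: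
  "coeff (kernel_poly (Suc M) X) (Suc M) = det_f (Suc M) X"
  "coeff (kernel_poly (Suc M) X) M = - det_g M X"
  "(if M = 0 then 0 else coeff (kernel_poly (Suc M) X) (M - 1)) = det_s M X"
  by (auto simp: coeff_kernel_poly minor_last minor_det_g det_s_def gr0_conv_Suc)

lemma coeff_linear_factor_kernel_poly:
  "coeff ([:y, 1:] * kernel_poly (Suc M) X) (M + 2) = det_f (Suc M) X"
  "coeff ([:y, 1:] * kernel_poly (Suc M) X) (M + 1) = y * det_f (Suc M) X - det_g M X"
  "coeff ([:y, 1:] * kernel_poly (Suc M) X) M = det_s M X - y * det_g M X"
proof -
  have [simp]: "coeff (kernel_poly (Suc M) X) (Suc (Suc M)) = 0"
    using degree_kernel_poly[of "Suc M" X] by (intro coeff_eq_0) simp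
  show "coeff ([:y, 1:] * kernel_poly (Suc M) X) (M + 2) = det_f (Suc M) X"
    "coeff ([:y, 1:] * kernel_poly (Suc M) X) (M + 1) = y * det_f (Suc M) X - det_g M X"
    by (simp_all add: coeff_kernel_poly_top)
  show "coeff ([:y, 1:] * kernel_poly (Suc M) X) M = det_s M X - y * det_g M X"
    using coeff_kernel_poly_top(3)[of M X]
    by (cases M) (simp_all add: coeff_kernel_poly_top coeff_kernel_poly_top[of 0, simplified])
qed

text \<open>The factor x + y moves the shift onto the last column, and the shifted rows annihilate
  their own kernel polynomial. The columns of \<open>X\<close> itself stay in front, so
  \<open>u\<close> vanishes below \<open>M\<close> and takes the values f, g, h from there
  on.\<close>

lemma bilinear_h:
  "det_f (Suc M) (shift_rows y X) * (y * det_g M X + det_h M X)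
    - det_g M (shift_rows y X) * (y * det_f (Suc M) X + det_g M X)
    + det_f (Suc M) X * det_s M (shift_rows y X) = 0"
proof -
  define u where "u = (\<lambda>l. det_lastcol M X (\<lambda>i. X i l))"
  let ?P = "[:y, 1:] * kernel_poly (Suc M) (shift_rows y X)"
  have "apply_poly u ?P = 0"
    unfolding apply_poly_linear_factor u_def shift_det_lastcol
        by (intro apply_poly_det_lastcol_eq_0 apply_poly_row_kernel_poly)
  moreover have "degree ?P \<le> M + 2"
    using degree_mult_le[of "[:y, 1:]" "kernel_poly (Suc M) (shift_rows y X)"]
        degree_kernel_poly[of "Suc M" "shift_rows y X"]
    by simp
  moreover have "u l = 0" if "l < M" for l
    unfolding u_def using that by (rule det_lastcol_repeat)
  ultimately have
    "0 = coeff ?P M * u M + coeff ?P (M + 1) * u (M + 1) + coeff ?P (M + 2) * u (M + 2)"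
    by (metis apply_poly_top_three)
  moreover have "u M = det_f (Suc M) X" "u (M + 1) = det_g M X" "u (M + 2) = det_h M X"
    by (simp_all only: u_def det_lastcol_self det_g_def det_h_def)
  ultimately show ?thesis
    unfolding coeff_linear_factor_kernel_poly by (simp only:) (simp add: algebra_simps)
qed

section \<open>Interpolation and the Hirota-Miwa equation\<close>

lemma cubic_division:
  fixes P :: "complex poly"
  obtains q r where "P = [:s1, 1:] * ([:s2, 1:] * ([:s3, 1:] * q)) + r" "degree r \<le> 2"
    "q = 0 \<or> degree q + 3 = degree P"
proof -
  let ?A = "[:s1, 1:] * ([:s2, 1:] * [:s3, 1:])"
  have A: "degree ?A = 3" by simp
  have P: "P = ?A * (P div ?A) + P mod ?A" by (rule mult_div_mod_eq[symmetric])
  have "?A \<noteq> 0" using A by auto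
  then have r: "degree (P mod ?A) \<le> 2"
    using degree_mod_less'[of ?A P] A by (cases "P mod ?A = 0") auto
  have "degree (P div ?A) + 3 = degree P" if q: "P div ?A \<noteq> 0"
  proof -
    have "degree (?A * (P div ?A)) = degree (P div ?A) + 3"
      using degree_mult_eq[OF \<open>?A \<noteq> 0\<close> q] A by linarith
    then show ?thesis
      using degree_add_eq_left[of "P mod ?A" "?A * (P div ?A)"] r P by simp
  qed
  then show ?thesis
    using that[of "P div ?A" "P mod ?A"] P r by (simp only: mult.assoc) blast
qed

text \<open>The front columns carry all three shifts. Hence a last column with two of them, taken at
  index 0, lacks exactly one shift and \<open>det_lastcol_shift_rows\<close> applies; the quotient
  \<open>q\<close> meets the fully shifted array. The term of \<open>P\<close> vanishes.\<close>

lemma kernel_interpolation: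
  assumes P: "P = [:s1, 1:] * ([:s2, 1:] * ([:s3, 1:] * q)) + r" and r: "degree r \<le> 2"
    and X: "\<And>i. i < Suc M \<Longrightarrow> apply_poly (X i) P = 0"
  defines "Y \<equiv> shift_rows s3 (shift_rows s2 (shift_rows s1 X))"
  shows "- ((s1 - s2) * (s1 - s3) * (s2 - s3)) * apply_poly (\<lambda>l. det_lastcol M Y (\<lambda>i. Y i l)) q =
    (- 1) ^ M * ((s2 - s3) * poly P (- s1) * det_f (Suc M) (shift_rows s2 (shift_rows s3 X))
    - (s1 - s3) * poly P (- s2) * det_f (Suc M) (shift_rows s1 (shift_rows s3 X))
    + (s1 - s2) * poly P (- s3) * det_f (Suc M) (shift_rows s1 (shift_rows s2 X)))"
proof -
  have Y: "det_lastcol M Y (\<lambda>i. shift_rows s2 (shift_rows s3 X) i 0) =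
      (- 1) ^ M * det_f (Suc M) (shift_rows s2 (shift_rows s3 X))"
    "det_lastcol M Y (\<lambda>i. shift_rows s1 (shift_rows s3 X) i 0) =
      (- 1) ^ M * det_f (Suc M) (shift_rows s1 (shift_rows s3 X))"
    "det_lastcol M Y (\<lambda>i. shift_rows s1 (shift_rows s2 X) i 0) =
      (- 1) ^ M * det_f (Suc M) (shift_rows s1 (shift_rows s2 X))"
    using det_lastcol_shift_rows[of M s1 "shift_rows s2 (shift_rows s3 X)"]
        det_lastcol_shift_rows[of M s2 "shift_rows s1 (shift_rows s3 X)"]
      det_lastcol_shift_rows[of M s3 "shift_rows s1 (shift_rows s2 X)"]
    unfolding Y_def by (metis shift_rows_commute)+
  have "apply_poly (\<lambda>l. det_lastcol M Y (\<lambda>i. X i l)) P = 0"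
    by (intro apply_poly_det_lastcol_eq_0 X)
  then show ?thesis
    using apply_poly_interpolation[OF P r, of "\<lambda>l. det_lastcol M Y (\<lambda>i. X i l)"]
    unfolding shift_det_lastcol Y_def[symmetric] Y by (simp add: algebra_simps)
qed

lemma hirota_miwa:
  "(s2 - s3) * det_f (Suc M) (shift_rows s1 X) * det_f (Suc M) (shift_rows s2 (shift_rows s3 X))
    - (s1 - s3) * det_f (Suc M) (shift_rows s2 X) * det_f (Suc M) (shift_rows s1 (shift_rows s3 X))
    + (s1 - s2) * det_f (Suc M) (shift_rows s3 X)
        * det_f (Suc M) (shift_rows s1 (shift_rows s2 X)) = 0"
proof -
  let ?P = "kernel_poly (Suc M) X"
  obtain q r where P: "?P = [:s1, 1:] * ([:s2, 1:] * ([:s3, 1:] * q)) + r" and r: "degree r \<le> 2"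
    and q: "q = 0 \<or> degree q + 3 = degree ?P"
    by (rule cubic_division)
  define Y where "Y = shift_rows s3 (shift_rows s2 (shift_rows s1 X))"
  \<comment> \<open>A nonzero \<open>q\<close> has degree below \<open>M\<close>, so only
    determinants with a repeated column occur.\<close>
  have "apply_poly (\<lambda>l. det_lastcol M Y (\<lambda>i. Y i l)) q = 0"
    using q
  proof
    assume "degree q + 3 = degree ?P"
    then have "degree q < M" using degree_kernel_poly[of "Suc M" X] by simp
    then show ?thesis
      unfolding apply_poly_def by (intro sum.neutral) (auto simp: det_lastcol_repeat)
  qed (simp add: apply_poly_0)
  with kernel_interpolation[OF P r, of M X] apply_poly_row_kernel_poly[of _ "Suc M" X]
  have "(s2 - s3) * poly ?P (- s1) * det_f (Suc M) (shift_rows s2 (shift_rows s3 X))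
    - (s1 - s3) * poly ?P (- s2) * det_f (Suc M) (shift_rows s1 (shift_rows s3 X))
    + (s1 - s2) * poly ?P (- s3) * det_f (Suc M) (shift_rows s1 (shift_rows s2 X)) = 0"
    by (simp add: Y_def)
  then have "(- 1) ^ M * ((s2 - s3) * det_f (Suc M) (shift_rows s1 X)
      * det_f (Suc M) (shift_rows s2 (shift_rows s3 X))
    - (s1 - s3) * det_f (Suc M) (shift_rows s2 X) * det_f (Suc M) (shift_rows s1 (shift_rows s3 X))
    + (s1 - s2) * det_f (Suc M) (shift_rows s3 X)
        * det_f (Suc M) (shift_rows s1 (shift_rows s2 X))) = 0"
    unfolding poly_kernel_poly by (simp add: algebra_simps)
  then show ?thesis by simp
qed

text \<open>The third direction of the Hirota--Miwa equation is \<open>-x\<close>, with \<open>x\<close> the polynomial variable.\<close>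

lemma hirota_miwa_poly:
  "smult (det_f (Suc M) (shift_rows a X)) ([:b, 1:] * kernel_poly (Suc M) (shift_rows b X))
    - smult (det_f (Suc M) (shift_rows b X)) ([:a, 1:] * kernel_poly (Suc M) (shift_rows a X))
    + smult ((a - b) * det_f (Suc M) (shift_rows a (shift_rows b X))) (kernel_poly (Suc M) X) = 0"
        (is "?P = 0")
proof -
  have "poly ?P x = 0" for x
  proof -
    have k: "poly (kernel_poly (Suc M) Z) x = (- 1) ^ Suc M
        * det_f (Suc M) (shift_rows (- x) Z)" for Z
      using poly_kernel_poly[of "Suc M" Z "- x"] by simp
    have "poly ?P x = (- 1) ^ Suc M * ((b - - x) * det_f (Suc M) (shift_rows a X)
        * det_f (Suc M) (shift_rows b (shift_rows (- x) X))
      - (a - - x) * det_f (Suc M) (shift_rows b X)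
        * det_f (Suc M) (shift_rows a (shift_rows (- x) X))
      + (a - b) * det_f (Suc M) (shift_rows (- x) X)
        * det_f (Suc M) (shift_rows a (shift_rows b X)))"
      unfolding shift_rows_commute[of b "- x"] shift_rows_commute[of a "- x"]
        by (simp add: k algebra_simps)
    then show ?thesis by (simp only: hirota_miwa mult_zero_right)
  qed
  then show ?thesis by (simp add: poly_eq_poly_eq_iff[symmetric] fun_eq_iff)
qed

text \<open>Coefficient of x^(M+1) in \<open>hirota_miwa_poly\<close>; at x^(M+2) the terms cancel
  identically.\<close>

lemma bilinear_g:
  "(a - b) * (det_f (Suc M) (shift_rows a X) * det_f (Suc M) (shift_rows b X)
      - det_f (Suc M) X * det_f (Suc M) (shift_rows a (shift_rows b X)))
    + det_f (Suc M) (shift_rows a X) * det_g M (shift_rows b X)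
    - det_f (Suc M) (shift_rows b X) * det_g M (shift_rows a X) = 0"
  using arg_cong[OF hirota_miwa_poly, of "\<lambda>P. coeff P (M + 1)" M a X b]
  unfolding coeff_add coeff_diff coeff_smult coeff_linear_factor_kernel_poly
  by (simp add: coeff_kernel_poly_top algebra_simps)

lemma bilinear_s_reduced:
  "det_f (Suc M) (shift_rows a X) * (det_s M (shift_rows b X) - b * det_g M (shift_rows b X))
    - det_f (Suc M) (shift_rows b X) * (det_s M (shift_rows a X) - a * det_g M (shift_rows a X))
    - (a - b) * det_f (Suc M) (shift_rows a (shift_rows b X)) * det_g M X = 0"
  using arg_cong[OF hirota_miwa_poly, of "\<lambda>P. coeff P M" M a X b]
  unfolding coeff_add coeff_diff coeff_smult coeff_linear_factor_kernel_poly
  by (simp add: coeff_kernel_poly_top algebra_simps)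

section \<open>The identity coming from the quartic condition\<close>

lemma bilinear_quartic:
  fixes e1 e2 e3 :: complex
  assumes K: "\<And>i l. i < Suc M \<Longrightarrow>
      (\<Sum>j<Suc M. K i j * X j l) =
      X i (l + 4) - e1 * X i (l + 3) + e2 * X i (l + 2) - e3 * X i (l + 1)"
    and ne: "s1 \<noteq> s3" "s2 \<noteq> s3"
  defines "Y \<equiv> shift_rows s1 (shift_rows s2 (shift_rows s3 X))"
  shows "(Qpol e1 e2 s1 s2 * det_f (Suc M) X * det_f (Suc M) Y + det_f (Suc M) X * det_h M Y
      - (s1 + s2 + e1) * det_f (Suc M) X * det_g M Y
      + ((s1 + s2 + e1) * det_f (Suc M) Y - det_g M Y) * (s3 * det_f (Suc M) X + det_g M X)
      + det_f (Suc M) Y * (s3^2 * det_f (Suc M) X + s3 * det_g M X + det_s M X)) * (s1 - s2)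
    - Rpol e1 e2 e3 s1 s3 * det_f (Suc M) (shift_rows s2 (shift_rows s3 X))
        * det_f (Suc M) (shift_rows s1 X)
    + Rpol e1 e2 e3 s2 s3 * det_f (Suc M) (shift_rows s1 (shift_rows s3 X))
        * det_f (Suc M) (shift_rows s2 X) = 0"
proof -
  let ?T = "kernel_poly (Suc M) X" and ?G = "[:0, - e3, e2, - e1, 1:]"
  let ?P = "?G * ?T"
  have "shift_rows s3 (shift_rows s2 (shift_rows s1 X)) = Y"
    unfolding Y_def by (metis shift_rows_commute)
  note Y' = this
  \<comment> \<open>Multiplication by \<open>?G\<close> acts on the rows as \<open>K\<close>, which
    yields combinations of rows, all annihilated by \<open>?T\<close>.\<close>
  have evP: "apply_poly (X i) ?P = 0" if i: "i < Suc M" for i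
  proof -
    have "apply_poly (X i) ?P = apply_poly (\<lambda>l. \<Sum>j<Suc M. K i j * X j l) ?T"
      unfolding K[OF i]
      by (simp add: apply_poly_add apply_poly_diff apply_poly_smult apply_poly_pCons)
        (simp add: apply_poly_def sum_distrib_left sum.distrib sum_subtractf sum_negf algebra_simps numeral_eq_Suc)
    also have "\<dots> = 0"
      unfolding apply_poly_lincomb by (rule sum.neutral) (simp add: apply_poly_row_kernel_poly)
    finally show ?thesis .
  qed
  obtain q r where P: "?P = [:s1, 1:] * ([:s2, 1:] * ([:s3, 1:] * q)) + r" and r: "degree r \<le> 2"
    and q: "q = 0 \<or> degree q + 3 = degree ?P"
    by (rule cubic_division)
  have "degree ?P \<le> M + 5"
    using degree_mult_le[of ?G ?T] degree_kernel_poly[of "Suc M" X] by simp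
  with q have dq: "degree q \<le> M + 2" by auto
  define w where "w = (\<lambda>l. det_lastcol M Y (\<lambda>i. Y i l))"
  have w: "w l = 0" if "l < M" for l
    unfolding w_def using that by (rule det_lastcol_repeat)
  have w': "w M = det_f (Suc M) Y" "w (M + 1) = det_g M Y" "w (M + 2) = det_h M Y"
    by (simp_all only: w_def det_lastcol_self det_g_def det_h_def)
  have r0: "coeff r k = 0" if "k \<ge> 3" for k
    using r that by (intro coeff_eq_0) simp
  have q0: "coeff q k = 0" if "k \<ge> M + 3" for k
    using dq that by (intro coeff_eq_0) simp
  have T0: "coeff ?T k = 0" if "k \<ge> M + 2" for k
    using degree_kernel_poly[of "Suc M" X] that by (intro coeff_eq_0) simp
  \<comment> \<open>The top three coefficients of \<open>q\<close> follow by comparison at x^(M+5),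
    x^(M+4), x^(M+3), where the remainder does not reach.\<close>
  have c5: "coeff q (M + 2) = det_f (Suc M) X"
    using arg_cong[OF P, of "\<lambda>P. coeff P (M + 5)"]
    by (simp add: eval_nat_numeral r0 q0 T0 coeff_kernel_poly_top)
  have c4: "coeff q (M + 1) + (s1 + s2 + s3) * coeff q (M + 2) = - det_g M X - e1 * det_f (Suc M) X"
    using arg_cong[OF P, of "\<lambda>P. coeff P (M + 4)"]
    by (simp add: eval_nat_numeral r0 q0 T0 coeff_kernel_poly_top algebra_simps)
  have c3: "coeff q M + (s1 + s2 + s3) * coeff q (M + 1)
        + (s1 * s2 + s1 * s3 + s2 * s3) * coeff q (M + 2) =
      det_s M X + e1 * det_g M X + e2 * det_f (Suc M) X"
    using arg_cong[OF P, of "\<lambda>P. coeff P (M + 3)"] coeff_kernel_poly_top(3)[of M X] T0[of "M + 2"]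
    by (cases M) (simp_all add: eval_nat_numeral r0 q0 T0 coeff_kernel_poly_top
        coeff_kernel_poly_top[of 0, simplified] algebra_simps)
  define f1 f2 f3 f12 f13 f23 where
    "f1 = det_f (Suc M) (shift_rows s1 X)" and "f2 = det_f (Suc M) (shift_rows s2 X)" and
    "f3 = det_f (Suc M) (shift_rows s3 X)" and
    "f12 = det_f (Suc M) (shift_rows s1 (shift_rows s2 X))" and
    "f13 = det_f (Suc M) (shift_rows s1 (shift_rows s3 X))" and
    "f23 = det_f (Suc M) (shift_rows s2 (shift_rows s3 X))"
  note fs = this
  define g where "g = (\<lambda>s. s^4 + e1 * s^3 + e2 * s^2 + e3 * s)"
  have pP: "poly ?P (- s) = (- 1) ^ Suc M * g s * det_f (Suc M) (shift_rows s X)" for s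
    unfolding poly_mult poly_kernel_poly by (simp add: g_def algebra_simps eval_nat_numeral)
  have "(s1 - s2) * (s1 - s3) * (s2 - s3) * apply_poly w q =
    (s2 - s3) * g s1 * f1 * f23 - (s1 - s3) * g s2 * f2 * f13 + (s1 - s2) * g s3 * f3 * f12"
    using kernel_interpolation[of ?P s1 s2 s3 q r M X, OF P r evP]
    unfolding Y' w_def[symmetric] pP fs
    by (simp add: algebra_simps flip: power_mult_distrib)
  moreover have "(s2 - s3) * f1 * f23 - (s1 - s3) * f2 * f13 + (s1 - s2) * f3 * f12 = 0"
    unfolding fs by (rule hirota_miwa)
  moreover have "g s1 - g s3 = (s1 - s3) * Rpol e1 e2 e3 s1 s3"
    "g s2 - g s3 = (s2 - s3) * Rpol e1 e2 e3 s2 s3"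
    by (simp_all add: g_def Rpol_def algebra_simps eval_nat_numeral)
  ultimately have "(s1 - s3) * (s2 - s3) * ((s1 - s2) * apply_poly w q) =
      (s1 - s3) * (s2 - s3) * (Rpol e1 e2 e3 s1 s3 * f23 * f1 - Rpol e1 e2 e3 s2 s3 * f13 * f2)"
    (is "?l = ?r")
  proof -
    assume lagrange: "(s1 - s2) * (s1 - s3) * (s2 - s3) * apply_poly w q =
        (s2 - s3) * g s1 * f1 * f23 - (s1 - s3) * g s2 * f2 * f13 + (s1 - s2) * g s3 * f3 * f12"
      and hm: "(s2 - s3) * f1 * f23 - (s1 - s3) * f2 * f13 + (s1 - s2) * f3 * f12 = 0"
      and R: "g s1 - g s3 = (s1 - s3) * Rpol e1 e2 e3 s1 s3"
        "g s2 - g s3 = (s2 - s3) * Rpol e1 e2 e3 s2 s3"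
    \<comment> \<open>Subtracting g(s3) times the Hirota-Miwa equation removes the product
      \<open>f3 * f12\<close> and leaves differences of g, which are divisible by s1 - s3 and s2 -
      s3.\<close>
    have "?l = (s2 - s3) * g s1 * f1 * f23 - (s1 - s3) * g s2 * f2 * f13
        + (s1 - s2) * g s3 * f3 * f12
        - g s3 * ((s2 - s3) * f1 * f23 - (s1 - s3) * f2 * f13 + (s1 - s2) * f3 * f12)"
      unfolding hm lagrange[symmetric] by (simp add: mult_ac)
    also have "\<dots> = (s2 - s3) * (g s1 - g s3) * f1 * f23 - (s1 - s3) * (g s2 - g s3) * f2 * f13"
      by (simp add: algebra_simps)
    also have "\<dots> = ?r"
      unfolding R by (simp add: algebra_simps)
    finally show ?thesis .
  qed
  then have main: "(s1 - s2) * apply_poly w q =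
      Rpol e1 e2 e3 s1 s3 * f23 * f1 - Rpol e1 e2 e3 s2 s3 * f13 * f2"
    using ne by simp
  \<comment> \<open>The bracket with Q is the functional at \<open>q\<close>, written through the
    top three coefficients of \<open>q\<close>.\<close>
  have ev_q: "Qpol e1 e2 s1 s2 * det_f (Suc M) X * det_f (Suc M) Y + det_f (Suc M) X * det_h M Y
      - (s1 + s2 + e1) * det_f (Suc M) X * det_g M Y
      + ((s1 + s2 + e1) * det_f (Suc M) Y - det_g M Y) * (s3 * det_f (Suc M) X + det_g M X)
      + det_f (Suc M) Y * (s3^2 * det_f (Suc M) X + s3 * det_g M X + det_s M X) =
      apply_poly w q"
  proof -
    have q1: "coeff q (M + 1) = - det_g M X - e1 * det_f (Suc M) X
        - (s1 + s2 + s3) * det_f (Suc M) X"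
      using c4 unfolding c5 by (simp add: algebra_simps)
    have q2: "coeff q M = det_s M X + e1 * det_g M X + e2 * det_f (Suc M) X
        - (s1 * s2 + s1 * s3 + s2 * s3) * det_f (Suc M) X
        + (s1 + s2 + s3) * (det_g M X + e1 * det_f (Suc M) X + (s1 + s2 + s3) * det_f (Suc M) X)"
      using c3 unfolding c5 q1 by (simp add: algebra_simps)
    have "apply_poly w q =
        coeff q M * w M + coeff q (M + 1) * w (M + 1) + coeff q (M + 2) * w (M + 2)"
      using dq w by (rule apply_poly_top_three)
    then show ?thesis
      unfolding w' c5 q1 q2 Qpol_def
      by (simp add: algebra_simps power2_eq_square)
  qed
  show ?thesis
    using main unfolding ev_q fs by (simp add: mult.commute mult.left_commute)
qed

text \<open>The comparison at x^M plus a multiple of the one at x^(M+1), used with b = \<sigma>3 and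
  \<open>X\<close> taken at \<alpha> - 1.\<close>

lemma bilinear_s:
  "det_f (Suc M) (shift_rows b X) *
      (b^2 * det_f (Suc M) (shift_rows a X) + b * det_g M (shift_rows a X) + det_s M (shift_rows a X))
    - a * det_f (Suc M) (shift_rows b X) *
      (b * det_f (Suc M) (shift_rows a X) + det_g M (shift_rows a X))
    + (a - b) * det_f (Suc M) (shift_rows a (shift_rows b X)) * (b * det_f (Suc M) X + det_g M X)
    - det_f (Suc M) (shift_rows a X) * det_s M (shift_rows b X) = 0"
    (is "?lhs = 0")
proof -
  let ?g = "(a - b) * (det_f (Suc M) (shift_rows a X) * det_f (Suc M) (shift_rows b X)
      - det_f (Suc M) X * det_f (Suc M) (shift_rows a (shift_rows b X)))
    + det_f (Suc M) (shift_rows a X) * det_g M (shift_rows b X)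
    - det_f (Suc M) (shift_rows b X) * det_g M (shift_rows a X)"
  let ?s = "det_f (Suc M) (shift_rows a X) * (det_s M (shift_rows b X) - b * det_g M (shift_rows b X))
    - det_f (Suc M) (shift_rows b X) * (det_s M (shift_rows a X) - a * det_g M (shift_rows a X))
    - (a - b) * det_f (Suc M) (shift_rows a (shift_rows b X)) * det_g M X"
  have "?lhs = - ?s - b * ?g"
    by (simp add: algebra_simps power2_eq_square)
  then show ?thesis
    by (simp only: bilinear_s_reduced bilinear_g mult_zero_right minus_zero diff_zero)
qed

section \<open>From Casoratians on the lattice to arrays\<close>

lemma cas_eq:
  assumes X: "\<And>i l. i < Suc M \<Longrightarrow> X i l = v l $ i"
  shows "cas (Suc M) v (f_idx (Suc M)) = det_f (Suc M) X"
    and "cas (Suc M) v (g_idx (Suc M)) = det_g M X"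
    and "cas (Suc M) v (h_idx (Suc M)) = det_h M X"
    and "cas (Suc M) v (s_idx (Suc M)) = det_s M X"
proof -
  have *: "cas (Suc M) v ls = det (mat (Suc M) (Suc M) (\<lambda>(i, j). X i (ls ! j)))"
    if "length ls = Suc M" for ls
    unfolding cas_def using that X by (auto intro!: arg_cong[where f = det] eq_matI)
  show "cas (Suc M) v (f_idx (Suc M)) = det_f (Suc M) X"
    by (subst *) (auto simp: f_idx_def det_f_def simp del: upt_Suc
        intro!: arg_cong[where f = det] eq_matI)
  show "cas (Suc M) v (g_idx (Suc M)) = det_g M X" "cas (Suc M) v (h_idx (Suc M)) = det_h M X"
    by (subst *; auto simp: g_idx_def h_idx_def det_g_def det_h_def det_lastcol_def nth_append less_Suc_eq
        intro!: arg_cong[where f = det] eq_matI)+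
  show "cas (Suc M) v (s_idx (Suc M)) = det_s M X"
  proof (cases M)
    \<comment> \<open>For N = 1 the list for s has two indices, so \<open>cas\<close> is 0 by its
      convention.\<close>
    case 0
    then show ?thesis by (simp add: cas_def s_idx_def det_s_def)
  next
    case (Suc k)
    then show ?thesis
      by (subst *) (auto simp: s_idx_def det_s_def minor_def nth_append less_Suc_eq
          intro!: arg_cong[where f = det] eq_matI)
  qed
qed

theorem theorem4p2:
  fixes \<alpha>1 \<alpha>2 \<alpha>3 \<delta> p q a b :: complex
    and N :: nat
    and K :: "complex mat"
    and \<phi> :: "int \<Rightarrow> int \<Rightarrow> int \<Rightarrow> int \<Rightarrow> nat \<Rightarrow> complex vec"
    and n m \<alpha> \<beta> :: int
  defines "\<sigma>1 \<equiv> p - \<delta>" and "\<sigma>2 \<equiv> q - \<delta>" and "\<sigma>3 \<equiv> a - \<delta>" and "\<sigma>4 \<equiv> b - \<delta>"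
    and "\<epsilon>1 \<equiv> 4*\<delta> - \<alpha>3"
    and "\<epsilon>2 \<equiv> 6*\<delta>^2 - 3*\<delta>*\<alpha>3 + \<alpha>2"
    and "\<epsilon>3 \<equiv> 4*\<delta>^3 - 3*\<delta>^2*\<alpha>3 + 2*\<delta>*\<alpha>2 - \<alpha>1"
    and "f \<equiv> \<lambda>x y z. cas N (\<phi> x y z \<beta>) (f_idx N)"
    and "g \<equiv> \<lambda>x y z. cas N (\<phi> x y z \<beta>) (g_idx N)"
    and "h \<equiv> \<lambda>x y z. cas N (\<phi> x y z \<beta>) (h_idx N)"
    and "s \<equiv> \<lambda>x y z. cas N (\<phi> x y z \<beta>) (s_idx N)"
  assumes distinct: "distinct [p, q, a, b]"
    and dim: "\<And>x y z w l. dim_vec (\<phi> x y z w l) = N"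
    and K: "K \<in> carrier_mat N N"
    and c1: "\<And>x y z w l. \<sigma>1 \<cdot>\<^sub>v \<phi> (x-1) y z w l = \<phi> x y z w l - \<phi> (x-1) y z w (l+1)"
    and c2: "\<And>x y z w l. \<sigma>2 \<cdot>\<^sub>v \<phi> x (y-1) z w l = \<phi> x y z w l - \<phi> x (y-1) z w (l+1)"
    and c3: "\<And>x y z w l. \<sigma>3 \<cdot>\<^sub>v \<phi> x y (z-1) w l = \<phi> x y z w l - \<phi> x y (z-1) w (l+1)"
    and c4: "\<And>x y z w l. \<sigma>4 \<cdot>\<^sub>v \<phi> x y z (w-1) l = \<phi> x y z w l - \<phi> x y z (w-1) (l+1)"
    and cK: "\<And>x y z w l. K *\<^sub>v \<phi> x y z w l =
        \<phi> x y z w (l+4) - \<epsilon>1 \<cdot>\<^sub>v \<phi> x y z w (l+3) + \<epsilon>2 \<cdot>\<^sub>v \<phi> x y z w (l+2)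
        - \<epsilon>3 \<cdot>\<^sub>v \<phi> x y z w (l+1)"
  shows
    "(f n m \<alpha> * (\<sigma>3 * f (n+1) m (\<alpha>-1) + g (n+1) m (\<alpha>-1))
       + (\<sigma>1 - \<sigma>3) * f (n+1) m \<alpha> * f n m (\<alpha>-1)
       - (\<sigma>1 * f n m \<alpha> + g n m \<alpha>) * f (n+1) m (\<alpha>-1) = 0)
   \<and> (f n m \<alpha> * (\<sigma>3 * f n (m+1) (\<alpha>-1) + g n (m+1) (\<alpha>-1))
       + (\<sigma>2 - \<sigma>3) * f n (m+1) \<alpha> * f n m (\<alpha>-1)
       - (\<sigma>2 * f n m \<alpha> + g n m \<alpha>) * f n (m+1) (\<alpha>-1) = 0)
   \<and> (f n m \<alpha> * (\<sigma>3^2 * f (n+1) m (\<alpha>-1) + \<sigma>3 * g (n+1) m (\<alpha>-1) + s (n+1) m (\<alpha>-1))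
       - \<sigma>1 * f n m \<alpha> * (\<sigma>3 * f (n+1) m (\<alpha>-1) + g (n+1) m (\<alpha>-1))
       + (\<sigma>1 - \<sigma>3) * f (n+1) m \<alpha> * (\<sigma>3 * f n m (\<alpha>-1) + g n m (\<alpha>-1))
       - f (n+1) m (\<alpha>-1) * s n m \<alpha> = 0)
   \<and> (f n m \<alpha> * (\<sigma>3^2 * f n (m+1) (\<alpha>-1) + \<sigma>3 * g n (m+1) (\<alpha>-1) + s n (m+1) (\<alpha>-1))
       - \<sigma>2 * f n m \<alpha> * (\<sigma>3 * f n (m+1) (\<alpha>-1) + g n (m+1) (\<alpha>-1))
       + (\<sigma>2 - \<sigma>3) * f n (m+1) \<alpha> * (\<sigma>3 * f n m (\<alpha>-1) + g n m (\<alpha>-1))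
       - f n (m+1) (\<alpha>-1) * s n m \<alpha> = 0)
   \<and> (f (n+1) m \<alpha> * (\<sigma>1 * g n m \<alpha> + h n m \<alpha>) - g (n+1) m \<alpha> * (\<sigma>1 * f n m \<alpha> + g n m \<alpha>)
       + f n m \<alpha> * s (n+1) m \<alpha> = 0)
   \<and> (f n (m+1) \<alpha> * (\<sigma>2 * g n m \<alpha> + h n m \<alpha>) - g n (m+1) \<alpha> * (\<sigma>2 * f n m \<alpha> + g n m \<alpha>)
       + f n m \<alpha> * s n (m+1) \<alpha> = 0)
   \<and> ((\<sigma>1 - \<sigma>2) * (f (n+1) m \<alpha> * f n (m+1) \<alpha> - f n m \<alpha> * f (n+1) (m+1) \<alpha>)
       + f (n+1) m \<alpha> * g n (m+1) \<alpha> - f n (m+1) \<alpha> * g (n+1) m \<alpha> = 0)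
   \<and> ((Qpol \<epsilon>1 \<epsilon>2 \<sigma>1 \<sigma>2 * f n m (\<alpha>-1) * f (n+1) (m+1) \<alpha>
        + f n m (\<alpha>-1) * h (n+1) (m+1) \<alpha>
        - (\<sigma>1 + \<sigma>2 + \<epsilon>1) * f n m (\<alpha>-1) * g (n+1) (m+1) \<alpha>
        + ((\<sigma>1 + \<sigma>2 + \<epsilon>1) * f (n+1) (m+1) \<alpha> - g (n+1) (m+1) \<alpha>)
            * (\<sigma>3 * f n m (\<alpha>-1) + g n m (\<alpha>-1))
        + f (n+1) (m+1) \<alpha> * (\<sigma>3^2 * f n m (\<alpha>-1) + \<sigma>3 * g n m (\<alpha>-1) + s n m (\<alpha>-1)))
       * (\<sigma>1 - \<sigma>2)
     - Rpol \<epsilon>1 \<epsilon>2 \<epsilon>3 \<sigma>1 \<sigma>3 * f n (m+1) \<alpha> * f (n+1) m (\<alpha>-1)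
     + Rpol \<epsilon>1 \<epsilon>2 \<epsilon>3 \<sigma>2 \<sigma>3 * f (n+1) m \<alpha> * f n (m+1) (\<alpha>-1) = 0)"
proof (cases N)
  case 0
  \<comment> \<open>The empty determinant is 1 and the other lists exceed N = 0. The last identity
    becomes (\<sigma>1 - \<sigma>2)(Q(\<sigma>1,\<sigma>2) + (\<sigma>1 + \<sigma>2 +
    \<epsilon>1)\<sigma>3 + \<sigma>3^2) = R(\<sigma>1,\<sigma>3) - R(\<sigma>2,\<sigma>3).\<close>
  have "f x y z = 1" "g x y z = 0" "h x y z = 0" "s x y z = 0" for x y z
    by (simp_all add: f_def g_def h_def s_def cas_def f_idx_def g_idx_def h_idx_def s_idx_def 0)
  then show ?thesis
    by (simp add: Qpol_def Rpol_def algebra_simps power2_eq_square)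
next
  case (Suc M)
  \<comment> \<open>Rows beyond \<open>N\<close> are set to \<open>0\<close>, so that the shift relations hold for every row.\<close>
  define R where "R = (\<lambda>x y z i l. if i < N then \<phi> x y z \<beta> l $ i else 0)"
  have R: "f x y z = det_f (Suc M) (R x y z)" "g x y z = det_g M (R x y z)"
    "h x y z = det_h M (R x y z)" "s x y z = det_s M (R x y z)" for x y z
    unfolding f_def g_def h_def s_def Suc
    by (intro cas_eq; simp add: R_def Suc)+
  have entry: "\<sigma> * u $ i + w $ i = v $ i"
    if "\<sigma> \<cdot>\<^sub>v u = v - w" "i < N" "dim_vec u = N" "dim_vec v = N" "dim_vec w = N"
    for \<sigma> :: complex and u v w i
    using arg_cong[OF that(1), of "\<lambda>v. v $ i"] that(2-) by simp
  have S1: "R (x + 1) y z = shift_rows \<sigma>1 (R x y z)" for x y z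
    using entry[OF c1[of "x + 1" y z \<beta>]]
    by (auto simp: R_def shift_rows_def shift_def dim fun_eq_iff)
  have S2: "R x (y + 1) z = shift_rows \<sigma>2 (R x y z)" for x y z
    using entry[OF c2[of x "y + 1" z \<beta>]]
    by (auto simp: R_def shift_rows_def shift_def dim fun_eq_iff)
  \<comment> \<open>Fixing \<alpha> keeps this a terminating rewrite rule down to the level \<alpha>
    - 1.\<close>
  have S3: "R x y \<alpha> = shift_rows \<sigma>3 (R x y (\<alpha> - 1))" for x y
    using entry[OF c3[of x y \<alpha> \<beta>]]
    by (auto simp: R_def shift_rows_def shift_def dim fun_eq_iff)
  \<comment> \<open>From this base point every lattice point in the identities is reached by upward
    shifts.\<close>
  define X where "X = R n m (\<alpha> - 1)"
  have quartic: "(\<Sum>j<Suc M. K $$ (i, j) * X j l) =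
      X i (l + 4) - \<epsilon>1 * X i (l + 3) + \<epsilon>2 * X i (l + 2) - \<epsilon>3 * X i (l + 1)"
    if "i < Suc M" for i l
    using arg_cong[OF cK[of n m "\<alpha> - 1" \<beta> l], of "\<lambda>v. v $ i"] that K dim
    by (simp add: X_def R_def Suc scalar_prod_def atLeast0LessThan del: sum.lessThan_Suc)
  have ne: "\<sigma>1 \<noteq> \<sigma>3" "\<sigma>2 \<noteq> \<sigma>3"
    using distinct by (auto simp: \<sigma>1_def \<sigma>2_def \<sigma>3_def)
  have X: "R n m \<alpha> = shift_rows \<sigma>3 X" "R (n + 1) m (\<alpha> - 1) = shift_rows \<sigma>1 X"
    "R n (m + 1) (\<alpha> - 1) = shift_rows \<sigma>2 X"
    "R (n + 1) m \<alpha> = shift_rows \<sigma>1 (shift_rows \<sigma>3 X)"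
    "R n (m + 1) \<alpha> = shift_rows \<sigma>2 (shift_rows \<sigma>3 X)"
    "R (n + 1) (m + 1) \<alpha> = shift_rows \<sigma>1 (shift_rows \<sigma>2 (shift_rows \<sigma>3 X))"
    by (simp_all only: X_def S1 S2 S3 shift_rows_commute)
  \<comment> \<open>Here \<open>s\<close> is a shift parameter, to be taken as \<sigma>1 and
    \<sigma>2 for the first two identities.\<close>
  have g: "det_f (Suc M) (shift_rows \<sigma>3 X) *
         (\<sigma>3 * det_f (Suc M) (shift_rows s X) + det_g M (shift_rows s X))
       + (s - \<sigma>3) * det_f (Suc M) (shift_rows s (shift_rows \<sigma>3 X)) * det_f (Suc M) X
       - (s * det_f (Suc M) (shift_rows \<sigma>3 X) + det_g M (shift_rows \<sigma>3 X))
         * det_f (Suc M) (shift_rows s X) = 0" for s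
    using bilinear_g[of s \<sigma>3 M X] by (simp add: algebra_simps)
  have g12: "(\<sigma>1 - \<sigma>2) *
        (det_f (Suc M) (shift_rows \<sigma>1 (shift_rows \<sigma>3 X)) * det_f (Suc M) (shift_rows \<sigma>2 (shift_rows \<sigma>3 X))
        - det_f (Suc M) (shift_rows \<sigma>3 X)
          * det_f (Suc M) (shift_rows \<sigma>1 (shift_rows \<sigma>2 (shift_rows \<sigma>3 X))))
      + det_f (Suc M) (shift_rows \<sigma>1 (shift_rows \<sigma>3 X)) * det_g M (shift_rows \<sigma>2 (shift_rows \<sigma>3 X))
      - det_f (Suc M) (shift_rows \<sigma>2 (shift_rows \<sigma>3 X)) * det_g M (shift_rows \<sigma>1 (shift_rows \<sigma>3 X)) = 0"
    by (rule bilinear_g)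
  show ?thesis
    unfolding R X X_def[symmetric]
    by (intro conjI g g12 bilinear_s bilinear_h bilinear_quartic[where K = "\<lambda>i j. K $$ (i, j)"]
        quartic ne)
qed

end
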